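(* Fix integers $q\ge2$, $1\le s\le t$, and $m\ge 1$. As $n\to\infty$, \[ \max_{\substack{x,y\in\Sigma_q^n\\ |I_s(x)\cap I_s(y)|\le m}} |I_t(x)\cap I_t(y)| \le \frac{m(q-1)^{t-s}}{(t-s)!}\,n^{t-s}+O_{q,s,t,m}\!\left(n^{t-s-1}\right). \]
   Context: $\Sigma_q$ is an alphabet of size $q\ge2$, and $\Sigma_q^n$ is the set of sequences of length $n$ over $\Sigma_q$. For sequences $x,w$, write $x\preccurlyeq w$ if $x$ is a (not necessarily contiguous) subsequence of $w$. For $x\in\Sigma_q^n$ and $t\ge0$, the $t$-insertion ball is $I_t(x)=\{w\in\Sigma_q^{n+t}: x\preccurlyeq w\}$. $O_{q,s,t,m}(f(n))$ denotes a quantity bounded in absolute value by $C f(n)$ for all sufficiently large $n$, where $C$ depends only on $q,s,t,m$. *)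

theory Defs
  imports Complex_Main "HOL-Library.Sublist" "HOL-Library.Landau_Symbols"
begin

(* Sigma_q^n, with the alphabet Sigma_q realised as {0, ..., q - 1}. *)
definition words :: "nat \<Rightarrow> nat \<Rightarrow> nat list set" where
  "words q n = {w. length w = n \<and> set w \<subseteq> {..<q}}"

(* The library predicate subseq is the not necessarily contiguous subsequence order. *)
definition insertion_ball :: "nat \<Rightarrow> nat \<Rightarrow> nat list \<Rightarrow> nat list set" where
  "insertion_ball q t x = {w \<in> words q (length x + t). subseq x w}"

(* Max is taken over a finite set. For q >= 2 and n > s that set is nonempty, because the
   two constant words 0...0 and 1...1 have disjoint s-insertion balls; for small n it can be
   empty, and then the value is unspecified. *)
definition max_intersection :: "nat \<Rightarrow> nat \<Rightarrow> nat \<Rightarrow> nat \<Rightarrow> nat \<Rightarrow> nat" where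
  "max_intersection q s t m n =
     Max {card (insertion_ball q t x \<inter> insertion_ball q t y) | x y.
            x \<in> words q n \<and> y \<in> words q n \<and>
            card (insertion_ball q s x \<inter> insertion_ball q s y) \<le> m}"

end

theory Submission
  imports Defs
begin

text \<open>
  Every word \<open>w\<close> in the intersection of the two \<open>t\<close>-balls contains a minimal common
  supersequence \<open>z\<close> of \<open>x\<close> and \<open>y\<close>. If \<open>z\<close> has length at most \<open>n + s\<close>, then \<open>w\<close> contains one of the
  at most \<open>m\<close> words of the intersection of the two \<open>s\<close>-balls, which leaves only \<open>t - s\<close> free
  insertions. Otherwise \<open>z\<close> has length \<open>n + r\<close> with \<open>s < r \<le> t\<close>. A minimal common supersequence
  starts with the first letter of \<open>x\<close> or of \<open>y\<close>, and so a Pascal-type recursion bounds the number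
  of those of length \<open>n + r\<close> by \<open>2r choose r\<close>, independently of \<open>n\<close>. Hence such words \<open>w\<close>
  contribute only \<open>O(n ^ (t - s - 1))\<close>.
\<close>

section \<open>Size of insertion balls\<close>

lemma finite_words: "finite (words q n)"
proof -
  have "words q n = {w. set w \<subseteq> {..<q} \<and> length w = n}"
    by (auto simp: words_def)
  then show ?thesis
    by (simp add: finite_lists_length_eq)
qed

lemma card_words: "card (words q n) = q ^ n"
proof -
  have "words q n = {w. set w \<subseteq> {..<q} \<and> length w = n}"
    by (auto simp: words_def)
  then show ?thesis
    by (simp add: card_lists_length_eq)
qed

lemma finite_insertion_ball: "finite (insertion_ball q k z)"
  by (rule finite_subset[OF _ finite_words]) (auto simp: insertion_ball_def)

lemma set_subseq_subset: "subseq x w \<Longrightarrow> set x \<subseteq> set w"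
  by (auto elim: list_emb_set)

text \<open>This is the classical size of a \<open>k\<close>-insertion ball whose members have
  length \<open>L\<close>; it depends on the centre only through its length. Only the upper bound is
  proved here.\<close>

definition ball_size :: "nat \<Rightarrow> nat \<Rightarrow> nat \<Rightarrow> nat" where
  "ball_size q L k = (\<Sum>i\<le>k. (L choose i) * (q - 1) ^ i)"

text \<open>Pascal's rule, summed over \<open>i\<close>. It has the shape of the first-letter
  recursion for insertion balls: one way to match the first letter of the centre,
  \<open>q - 1\<close> ways to insert another letter before it.\<close>

lemma ball_size_Suc_Suc:
  "ball_size q (Suc L) (Suc k) = ball_size q L (Suc k) + (q - 1) * ball_size q L k"
  unfolding ball_size_def
  by (subst (1 2) sum.atMost_Suc_shift)
     (simp add: distrib_right distrib_left sum.distrib sum_distrib_left mult.left_commute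
       del: diff_Suc_1 One_nat_def)

lemma ball_size_pos: "ball_size q L k \<ge> 1"
  unfolding ball_size_def by (cases k) (simp_all add: sum.atMost_Suc_shift del: sum.atMost_Suc)

lemma ball_size_diag:
  assumes "q \<ge> 1"
  shows "ball_size q k k = q ^ k"
  using binomial[of "q - 1" 1 k] assms by (simp add: ball_size_def)

text \<open>Split on the first letter of \<open>w\<close>. If it matches that of the centre, the
  tail contains the rest of the centre with all \<open>k\<close> insertions left; otherwise it is an
  insertion, and the tail still contains the whole centre with one insertion fewer. Hence the
  induction on \<open>z\<close> with an inner one on \<open>k\<close>.\<close>

lemma card_insertion_ball_le:
  assumes q: "q \<ge> 1"
  shows "card (insertion_ball q k z) \<le> ball_size q (length z + k) k"
proof (induction z arbitrary: k)
  case Nil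
  then show ?case
    using q by (simp add: insertion_ball_def card_words ball_size_diag)
next
  case (Cons a z)
  note IH_z = this
  show ?case
  proof (induction k)
    case 0
    have "insertion_ball q 0 (a # z) \<subseteq> {a # z}"
      by (auto simp: insertion_ball_def words_def dest: subseq_same_length)
    then have "card (insertion_ball q 0 (a # z)) \<le> 1"
      using card_mono[of "{a # z}"] by simp
    then show ?case
      using ball_size_pos[of q "length (a # z) + 0" 0] by linarith
  next
    case (Suc k)
    let ?B = "insertion_ball q (Suc k) (a # z)"
    let ?A = "(#) a ` insertion_ball q (Suc k) z"
    let ?C = "\<Union>c\<in>{..<q} - {a}. (#) c ` insertion_ball q k (a # z)"
    have le_A: "card ?A \<le> ball_size q (length z + Suc k) (Suc k)"
      using card_image_le[OF finite_insertion_ball] IH_z le_trans by blast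
    show ?case
    proof (cases "a < q")
      \<comment> \<open>The centre may have letters outside the alphabet, and then its ball is
        empty. In the other case, removing \<open>a\<close> leaves exactly \<open>q - 1\<close>
        letters.\<close>
      case False
      then have "?B = {}"
        by (auto simp: insertion_ball_def words_def dest!: set_subseq_subset)
      then show ?thesis by simp
    next
      case True
      have "?B \<subseteq> ?A \<union> ?C"
      proof
        fix w assume "w \<in> ?B"
        then show "w \<in> ?A \<union> ?C"
          by (cases w) (auto simp: insertion_ball_def words_def split: if_splits)
      qed
      moreover have "finite (?A \<union> ?C)"
        by (simp add: finite_insertion_ball)
      ultimately have "card ?B \<le> card ?A + card ?C"
        using card_mono card_Un_le le_trans by metis
      also have "card ?C \<le> (\<Sum>c\<in>{..<q} - {a}. card ((#) c ` insertion_ball q k (a # z)))"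
        by (rule card_UN_le) simp
      also have "\<dots> \<le> (\<Sum>c\<in>{..<q} - {a}. ball_size q (length (a # z) + k) k)"
        using card_image_le[OF finite_insertion_ball] Suc.IH le_trans by (intro sum_mono) blast
      also have "\<dots> = (q - 1) * ball_size q (length (a # z) + k) k"
        using True by simp
      finally show ?thesis
        using le_A by (simp add: ball_size_Suc_Suc)
    qed
  qed
qed

section \<open>Minimal common supersequences\<close>

text \<open>Minimality refers to the subsequence order, not to length, so one pair can have minimal
  common supersequences of several lengths; \<open>L\<close> sorts them.\<close>

definition min_supseqs :: "'a list \<Rightarrow> 'a list \<Rightarrow> nat \<Rightarrow> 'a list set" where
  "min_supseqs x y L = {z. length z = L \<and> subseq x z \<and> subseq y z \<and>
     (\<forall>z'. subseq x z' \<longrightarrow> subseq y z' \<longrightarrow> subseq z' z \<longrightarrow> z' = z)}"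

lemma min_supseqs_commute: "min_supseqs x y L = min_supseqs y x L"
  by (auto simp: min_supseqs_def)

lemma min_supseqs_Nil: "min_supseqs [] y L \<subseteq> {y}"
  by (auto simp: min_supseqs_def)

text \<open>A first letter of \<open>z\<close> other than \<open>a\<close> could be deleted, against
  minimality. The tail is minimal because a smaller common supersequence of \<open>x\<close> and
  \<open>y\<close> inside it could be prefixed with \<open>a\<close>.\<close>

lemma min_supseqs_Cons_Cons_same:
  "min_supseqs (a # x) (a # y) (Suc L) \<subseteq> (#) a ` min_supseqs x y L"
proof
  fix z assume z: "z \<in> min_supseqs (a # x) (a # y) (Suc L)"
  then have min: "\<And>z'. subseq (a # x) z' \<Longrightarrow> subseq (a # y) z' \<Longrightarrow> subseq z' z \<Longrightarrow> z' = z"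
    by (auto simp: min_supseqs_def)
  from z obtain c z0 where zc: "z = c # z0" "length z0 = L"
    by (cases z) (auto simp: min_supseqs_def)
  have "c = a"
  proof (rule ccontr)
    assume "c \<noteq> a"
    then have "z0 = z"
      using z zc by (intro min) (auto simp: min_supseqs_def)
    then show False using zc by simp
  qed
  moreover have "z0 \<in> min_supseqs x y L"
    using z zc \<open>c = a\<close> min[of "a # _"] by (auto simp: min_supseqs_def)
  ultimately show "z \<in> (#) a ` min_supseqs x y L"
    using zc by blast
qed

text \<open>A first letter that starts neither word could be deleted. If it is \<open>a\<close>,
  only the first word is shortened, since \<open>b # y\<close> must already embed in the tail; the
  case of \<open>b\<close> is symmetric.\<close>

lemma min_supseqs_Cons_Cons_diff:
  assumes "a \<noteq> b"
  shows "min_supseqs (a # x) (b # y) (Suc L) \<subseteq>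
    (#) a ` min_supseqs x (b # y) L \<union> (#) b ` min_supseqs (a # x) y L"
proof
  fix z assume z: "z \<in> min_supseqs (a # x) (b # y) (Suc L)"
  then have min: "\<And>z'. subseq (a # x) z' \<Longrightarrow> subseq (b # y) z' \<Longrightarrow> subseq z' z \<Longrightarrow> z' = z"
    by (auto simp: min_supseqs_def)
  from z obtain c z0 where zc: "z = c # z0" "length z0 = L"
    by (cases z) (auto simp: min_supseqs_def)
  have "c = a \<or> c = b"
  proof (rule ccontr)
    assume "\<not> (c = a \<or> c = b)"
    then have "z0 = z"
      using z zc by (intro min) (auto simp: min_supseqs_def)
    then show False using zc by simp
  qed
  then show "z \<in> (#) a ` min_supseqs x (b # y) L \<union> (#) b ` min_supseqs (a # x) y L"
  proof
    assume c: "c = a"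
    have "z0 \<in> min_supseqs x (b # y) L"
      using z zc c assms min[of "a # _"] by (auto simp: min_supseqs_def)
    then show ?thesis using zc c by blast
  next
    assume c: "c = b"
    have "z0 \<in> min_supseqs (a # x) y L"
      using z zc c assms min[of "b # _"] by (auto simp: min_supseqs_def)
    then show ?thesis using zc c by blast
  qed
qed

lemma min_supseqs_too_short:
  assumes "L < length x \<or> L < length y"
  shows "min_supseqs x y L = {}"
  using assms by (auto simp: min_supseqs_def dest!: list_emb_length)

text \<open>The bound sees only the excess lengths \<open>i\<close> and \<open>j\<close> of
  \<open>z\<close> over \<open>x\<close> and \<open>y\<close>. A common first letter preserves both;
  a letter taken from \<open>x\<close> alone lowers \<open>j\<close>, one taken from
  \<open>y\<close> alone lowers \<open>i\<close>, and Pascal's rule adds the two counts.\<close>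

lemma card_min_supseqs_le:
  assumes "length x + i = L" and "length y + j = L"
  shows "finite (min_supseqs x y L) \<and> card (min_supseqs x y L) \<le> (i + j) choose i"
  using assms
proof (induction L arbitrary: x y i j)
  case 0
  then have "min_supseqs x y 0 \<subseteq> {y}"
    using min_supseqs_Nil[of y] by simp
  then show ?case
    using 0 finite_subset[of _ "{y}"] card_mono[of "{y}"] by force
next
  case (Suc L)
  have one: "(1::nat) \<le> (i + j) choose i"
    by (simp add: Suc_leI)
  have singleton: ?case if "min_supseqs x y (Suc L) \<subseteq> {z}" for z
    using that one finite_subset[OF that] card_mono[OF _ that] by force
  show ?case
  proof (cases x)
    case Nil
    then show ?thesis
      using min_supseqs_Nil singleton by blast
  next
    case (Cons a x')
    note x = this
    show ?thesis
    proof (cases y)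
      case Nil
      then show ?thesis
        using min_supseqs_Nil min_supseqs_commute singleton by metis
    next
      case (Cons b y')
      note y = this
      show ?thesis
      proof (cases "a = b")
        case True
        have IH: "finite (min_supseqs x' y' L)" "card (min_supseqs x' y' L) \<le> (i + j) choose i"
          using Suc.IH[of x' i y' j] Suc.prems x y by auto
        have "min_supseqs x y (Suc L) \<subseteq> (#) a ` min_supseqs x' y' L"
          using min_supseqs_Cons_Cons_same True x y by metis
        then show ?thesis
          using IH finite_subset surj_card_le le_trans by (metis finite_imageI)
      next
        case False
        let ?A = "min_supseqs x' y L" and ?B = "min_supseqs x y' L"
        \<comment> \<open>If \<open>j = 0\<close>, then \<open>y\<close> is longer than
          \<open>L\<close> and no supersequence of that length exists, whence the value 0; likewise
          for \<open>i = 0\<close> below.\<close>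
        have A: "finite ?A \<and> card ?A \<le> (case j of 0 \<Rightarrow> 0 | Suc j' \<Rightarrow> (i + j') choose i)"
          using Suc.IH[of x' i y "j - 1"] Suc.prems x min_supseqs_too_short[of L x' y]
          by (cases j) auto
        have B: "finite ?B \<and> card ?B \<le> (case i of 0 \<Rightarrow> 0 | Suc i' \<Rightarrow> (i' + j) choose i')"
          using Suc.IH[of x "i - 1" y' j] Suc.prems y min_supseqs_too_short[of L x y']
          by (cases i) auto
        have sub: "min_supseqs x y (Suc L) \<subseteq> (#) a ` ?A \<union> (#) b ` ?B"
          using min_supseqs_Cons_Cons_diff[OF False] x y by blast
        have "card (min_supseqs x y (Suc L)) \<le> card ((#) a ` ?A \<union> (#) b ` ?B)"
          using A B by (intro card_mono sub) auto
        also have "\<dots> \<le> card ?A + card ?B"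
          using A B card_Un_le card_image_le add_mono le_trans by meson
        also have "\<dots> \<le> (case j of 0 \<Rightarrow> 0 | Suc j' \<Rightarrow> (i + j') choose i)
            + (case i of 0 \<Rightarrow> 0 | Suc i' \<Rightarrow> (i' + j) choose i')"
          using A B by linarith
        also have "\<dots> \<le> (i + j) choose i"
          by (cases i; cases j) auto
        finally show ?thesis
          using sub A B finite_subset by (metis finite_UnI finite_imageI)
      qed
    qed
  qed
qed

lemma obtain_min_supseq:
  assumes "subseq x w" and "subseq y w"
  obtains z where "z \<in> min_supseqs x y (length z)" and "subseq z w"
proof -
  have "\<exists>z. z \<in> min_supseqs x y (length z) \<and> subseq z w"
    using assms
  proof (induction w rule: length_induct)
    case (1 w)
    show ?case
    proof (cases "w \<in> min_supseqs x y (length w)")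
      case False
      then obtain w' where w': "subseq x w'" "subseq y w'" "subseq w' w" "w' \<noteq> w"
        using 1 by (auto simp: min_supseqs_def)
      then have "length w' < length w"
        using list_emb_length subseq_same_length le_neq_implies_less by metis
      then show ?thesis
        using 1 w' subseq_order.trans by blast
    qed auto
  qed
  then show thesis using that by blast
qed

text \<open>Used to pad a short common supersequence, with letters of \<open>w\<close>, to the exact
  length that membership in the \<open>s\<close>-balls requires.\<close>

lemma obtain_subseq_between:
  assumes "subseq z w" and "length z \<le> L" and "L \<le> length w"
  obtains u where "subseq z u" and "subseq u w" and "length u = L"
proof -
  have "\<exists>u. subseq z u \<and> subseq u w \<and> length u = L"
    using assms
  proof (induction z w arbitrary: L rule: list_emb.induct)
    case (list_emb_Nil w)
    then show ?case
      by (intro exI[of _ "take L w"]) (auto intro: prefix_imp_subseq take_is_prefix)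
  next
    case (list_emb_Cons z w c)
    show ?case
    proof (cases "L \<le> length w")
      case True
      then show ?thesis
        using list_emb_Cons by (meson list_emb.list_emb_Cons)
    next
      case False
      then have "L = length (c # w)"
        using list_emb_Cons.prems by simp
      then show ?thesis
        using list_emb_Cons.hyps by (intro exI[of _ "c # w"]) auto
    qed
  next
    case (list_emb_Cons2 a b z w)
    then obtain L' where L': "L = Suc L'"
      by (cases L) auto
    then obtain u where "subseq z u" "subseq u w" "length u = L'"
      using list_emb_Cons2 by auto
    then show ?case
      using list_emb_Cons2.hyps L' by (intro exI[of _ "b # u"]) auto
  qed
  then show thesis using that by blast
qed

section \<open>The intersection of two insertion balls\<close>

lemma card_insertion_ball_Int_le:
  assumes q: "q \<ge> 1" and st: "s \<le> t"
    and x: "length x = n" and y: "length y = n"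
    and m: "card (insertion_ball q s x \<inter> insertion_ball q s y) \<le> m"
  shows "card (insertion_ball q t x \<inter> insertion_ball q t y)
    \<le> m * ball_size q (n + t) (t - s)
      + (\<Sum>r\<in>{s<..t}. ((2 * r) choose r) * ball_size q (n + t) (t - r))"
proof -
  let ?S = "insertion_ball q s x \<inter> insertion_ball q s y"
  let ?A = "\<Union>z\<in>?S. insertion_ball q (t - s) z"
  let ?M = "\<lambda>r. min_supseqs x y (n + r)"
  let ?B = "\<lambda>r. \<Union>z\<in>?M r. insertion_ball q (t - r) z"
  \<comment> \<open>Both words have length \<open>n\<close>, so both excesses equal
    \<open>r\<close>.\<close>
  have M: "finite (?M r)" "card (?M r) \<le> (2 * r) choose r" for r
    using card_min_supseqs_le[of x r "n + r" y r] x y by (auto simp: mult_2)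
  have finS: "finite ?S"
    by (simp add: finite_insertion_ball)
  have A: "card ?A \<le> m * ball_size q (n + t) (t - s)"
  proof -
    have "card ?A \<le> (\<Sum>z\<in>?S. card (insertion_ball q (t - s) z))"
      by (rule card_UN_le[OF finS])
    also have "\<dots> \<le> (\<Sum>z\<in>?S. ball_size q (n + t) (t - s))"
    proof (rule sum_mono)
      fix z assume "z \<in> ?S"
      then have "length z + (t - s) = n + t"
        using x st by (auto simp: insertion_ball_def words_def)
      then show "card (insertion_ball q (t - s) z) \<le> ball_size q (n + t) (t - s)"
        using card_insertion_ball_le[OF q, of "t - s" z] by simp
    qed
    also have "\<dots> \<le> m * ball_size q (n + t) (t - s)"
      using m by (simp add: mult_le_mono1)
    finally show ?thesis .
  qed
  have B: "card (?B r) \<le> ((2 * r) choose r) * ball_size q (n + t) (t - r)" if "r \<le> t" for r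
  proof -
    have "card (?B r) \<le> (\<Sum>z\<in>?M r. card (insertion_ball q (t - r) z))"
      by (rule card_UN_le[OF M(1)])
    also have "\<dots> \<le> (\<Sum>z\<in>?M r. ball_size q (n + t) (t - r))"
    proof (rule sum_mono)
      fix z assume "z \<in> ?M r"
      then have "length z + (t - r) = n + t"
        using that by (auto simp: min_supseqs_def)
      then show "card (insertion_ball q (t - r) z) \<le> ball_size q (n + t) (t - r)"
        using card_insertion_ball_le[OF q, of "t - r" z] by simp
    qed
    also have "\<dots> \<le> ((2 * r) choose r) * ball_size q (n + t) (t - r)"
      using M(2)[of r] by (simp add: mult_le_mono1)
    finally show ?thesis .
  qed
  have "insertion_ball q t x \<inter> insertion_ball q t y \<subseteq> ?A \<union> (\<Union>r\<in>{s<..t}. ?B r)"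
  proof
    fix w assume "w \<in> insertion_ball q t x \<inter> insertion_ball q t y"
    then have w: "length w = n + t" "set w \<subseteq> {..<q}" "subseq x w" "subseq y w"
      using x by (auto simp: insertion_ball_def words_def)
    obtain z where z: "z \<in> min_supseqs x y (length z)" "subseq z w"
      using obtain_min_supseq w by blast
    then have xyz: "subseq x z" "subseq y z"
      by (auto simp: min_supseqs_def)
    show "w \<in> ?A \<union> (\<Union>r\<in>{s<..t}. ?B r)"
    proof (cases "length z \<le> n + s")
      case True
      \<comment> \<open>The minimal \<open>z\<close> may be shorter than \<open>n + s\<close>.
        Padding inside \<open>w\<close> keeps the letters in the alphabet, so \<open>u\<close> lies
        in both \<open>s\<close>-balls.\<close>
      obtain u where u: "subseq z u" "subseq u w" "length u = n + s"
        using obtain_subseq_between[OF z(2) True] w st by auto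
      have "subseq x u" "subseq y u"
        using xyz u subseq_order.trans by blast+
      moreover have "set u \<subseteq> {..<q}"
        using set_subseq_subset u(2) w(2) by blast
      ultimately have "u \<in> ?S"
        using u x y by (auto simp: insertion_ball_def words_def)
      moreover have "w \<in> insertion_ball q (t - s) u"
        using w u st by (auto simp: insertion_ball_def words_def)
      ultimately show ?thesis by blast
    next
      case False
      define r where "r = length z - n"
      have r: "length z = n + r" "s < r" "r \<le> t"
        using False list_emb_length[OF z(2)] w by (auto simp: r_def)
      then have "w \<in> insertion_ball q (t - r) z"
        using w z by (auto simp: insertion_ball_def words_def)
      moreover have "z \<in> ?M r"
        using z r by simp
      ultimately show ?thesis
        using r by (intro UnI2) auto
    qed
  qed
  then have "card (insertion_ball q t x \<inter> insertion_ball q t y)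
      \<le> card (?A \<union> (\<Union>r\<in>{s<..t}. ?B r))"
    using finS M by (intro card_mono) (auto simp: finite_insertion_ball)
  also have "\<dots> \<le> card ?A + card (\<Union>r\<in>{s<..t}. ?B r)"
    by (rule card_Un_le)
  also have "card (\<Union>r\<in>{s<..t}. ?B r) \<le> (\<Sum>r\<in>{s<..t}. card (?B r))"
    by (rule card_UN_le) simp
  also have "\<dots> \<le> (\<Sum>r\<in>{s<..t}. ((2 * r) choose r) * ball_size q (n + t) (t - r))"
    by (rule sum_mono) (use B in auto)
  finally show ?thesis
    using A by simp
qed

lemma max_intersection_le:
  assumes q: "q \<ge> 2" and st: "s \<le> t" and n: "n > s"
  shows "max_intersection q s t m n \<le> m * ball_size q (n + t) (t - s)
      + (\<Sum>r\<in>{s<..t}. ((2 * r) choose r) * ball_size q (n + t) (t - r))" (is "_ \<le> ?b")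
proof -
  let ?I = "\<lambda>t x y. card (insertion_ball q t x \<inter> insertion_ball q t y)"
  let ?X = "{?I t x y | x y. x \<in> words q n \<and> y \<in> words q n \<and> ?I s x y \<le> m}"
  have "?X \<subseteq> (\<lambda>(x, y). ?I t x y) ` (words q n \<times> words q n)"
    by auto
  then have fin: "finite ?X"
    by (rule finite_subset) (simp add: finite_words)
  \<comment> \<open>A pair that makes the set under \<open>Max\<close> nonempty: a common
    supersequence needs \<open>n\<close> zeros and \<open>n\<close> ones, and
    \<open>2 * n > n + s\<close>.\<close>
  let ?x = "replicate n (0::nat)" and ?y = "replicate n (1::nat)"
  have "insertion_ball q s ?x \<inter> insertion_ball q s ?y = {}"
  proof (rule ccontr)
    assume "insertion_ball q s ?x \<inter> insertion_ball q s ?y \<noteq> {}"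
    then obtain w where w: "length w = n + s" "subseq ?x w" "subseq ?y w"
      by (auto simp: insertion_ball_def words_def)
    have "n \<le> length (filter ((=) 0) w)" "n \<le> length (filter ((=) 1) w)"
      using list_emb_length[OF subseq_filter[OF w(2), of "(=) 0"]]
        list_emb_length[OF subseq_filter[OF w(3), of "(=) 1"]] by simp_all
    moreover have "length (filter ((=) 0) w) + length (filter ((=) 1) w) \<le> length w"
      by (induction w) auto
    ultimately show False
      using w(1) n by linarith
  qed
  then have "?I s ?x ?y \<le> m" by simp
  moreover have "?x \<in> words q n" "?y \<in> words q n"
    using q by (auto simp: words_def)
  ultimately have "?X \<noteq> {}" by blast
  moreover have "\<forall>v\<in>?X. v \<le> ?b"
    using card_insertion_ball_Int_le[of q s t _ n _ m] q st by (auto simp: words_def)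
  ultimately show ?thesis
    unfolding max_intersection_def using fin by (intro Max.boundedI) blast+
qed

section \<open>Asymptotics\<close>

text \<open>The factors \<open>2 ^ i\<close> come from \<open>n + t \<le> 2 * n\<close>. The free
  exponent \<open>j\<close> lets balls of different radii be bounded by the same power of
  \<open>n\<close>.\<close>

lemma ball_size_le_power:
  assumes "n \<ge> 1" and "t \<le> n" and "k \<le> j"
  shows "real (ball_size q (n + t) k) \<le> (\<Sum>i\<le>k. 2 ^ i * real (q - 1) ^ i) * real n ^ j"
proof -
  have "real (((n + t) choose i) * (q - 1) ^ i) \<le> 2 ^ i * real (q - 1) ^ i * real n ^ j"
    if "i \<le> k" for i
  proof -
    have "real ((n + t) choose i) \<le> real ((n + t) ^ i)"
      using binomial_le_pow[of i "n + t"]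
      by (cases "i \<le> n + t") (auto simp: binomial_eq_0 simp del: of_nat_power)
    also have "\<dots> \<le> (2 * real n) ^ i"
      using assms by (subst of_nat_power, intro power_mono) auto
    also have "\<dots> \<le> 2 ^ i * real n ^ j"
      using assms that by (auto simp: power_mult_distrib intro!: power_increasing)
    finally have "real ((n + t) choose i) * real (q - 1) ^ i
        \<le> 2 ^ i * real n ^ j * real (q - 1) ^ i"
      by (intro mult_right_mono) auto
    then show ?thesis
      by (simp add: mult_ac)
  qed
  then show ?thesis
    unfolding ball_size_def of_nat_sum sum_distrib_right by (intro sum_mono) simp
qed

text \<open>Replacing \<open>n\<close> by \<open>n + t\<close> must not change the leading
  coefficient, so the term \<open>a ^ Suc j\<close> is kept exactly;
  \<open>a + b \<le> 2 * a\<close> gives the crude constant in the error term.\<close>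

lemma power_add_le:
  fixes a b :: real
  assumes "0 \<le> b" and "b \<le> a"
  shows "(a + b) ^ Suc j \<le> a ^ Suc j + (2 ^ Suc j * b) * a ^ j"
proof (induction j)
  case 0
  then show ?case using assms by simp
next
  case (Suc j)
  have "(a + b) ^ Suc (Suc j) = a * (a + b) ^ Suc j + b * (a + b) ^ Suc j"
    by (simp add: algebra_simps)
  also have "\<dots> \<le> a * (a ^ Suc j + (2 ^ Suc j * b) * a ^ j) + b * (2 * a) ^ Suc j"
    using Suc assms by (intro add_mono mult_left_mono power_mono) auto
  also have "\<dots> = a ^ Suc (Suc j) + (2 ^ Suc (Suc j) * b) * a ^ Suc j"
    by (simp add: algebra_simps power_mult_distrib)
  finally show ?case .
qed

text \<open>Only the summand \<open>i = Suc j\<close> reaches the leading order; the others form the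
  ball size of radius \<open>j\<close>.\<close>

lemma ball_size_asymp:
  obtains C where "\<And>n. n \<ge> 1 \<Longrightarrow> t \<le> n \<Longrightarrow>
    real (ball_size q (n + t) (Suc j))
      \<le> real (q - 1) ^ Suc j / fact (Suc j) * real n ^ Suc j + C * real n ^ j"
proof
  let ?D = "\<Sum>i\<le>j. 2 ^ i * real (q - 1) ^ i"
  let ?E = "real (q - 1) ^ Suc j / fact (Suc j)"
  let ?C = "?E * (2 ^ Suc j * real t) + ?D"
  fix n assume n: "n \<ge> 1" "t \<le> n"
  have "fact (Suc j) * real ((n + t) choose Suc j) \<le> real (n + t) ^ Suc j"
    using binomial_fact_pow[of "n + t" "Suc j"]
    by (metis mult.commute of_nat_fact of_nat_le_iff of_nat_mult of_nat_power)
  then have "real ((n + t) choose Suc j) \<le> real (n + t) ^ Suc j / fact (Suc j)"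
    by (simp add: pos_le_divide_eq mult.commute del: fact_Suc power_Suc)
  also have "\<dots> \<le> (real n ^ Suc j + (2 ^ Suc j * real t) * real n ^ j) / fact (Suc j)"
    using power_add_le[of "real t" "real n" j] n
    by (intro divide_right_mono) (auto simp del: power_Suc)
  finally have "real ((n + t) choose Suc j) * real (q - 1) ^ Suc j
      \<le> (real n ^ Suc j + (2 ^ Suc j * real t) * real n ^ j) / fact (Suc j) * real (q - 1) ^ Suc j"
    by (intro mult_right_mono) auto
  also have "\<dots> = ?E * real n ^ Suc j + ?E * (2 ^ Suc j * real t) * real n ^ j"
    by (simp add: field_simps del: fact_Suc power_Suc)
  finally have "real ((n + t) choose Suc j) * real (q - 1) ^ Suc j
      \<le> ?E * real n ^ Suc j + ?E * (2 ^ Suc j * real t) * real n ^ j" .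
  moreover have "real (ball_size q (n + t) j) \<le> ?D * real n ^ j"
    using ball_size_le_power n by blast
  moreover have "real (ball_size q (n + t) (Suc j))
      = real (ball_size q (n + t) j) + real ((n + t) choose Suc j) * real (q - 1) ^ Suc j"
    by (simp add: ball_size_def)
  ultimately show "real (ball_size q (n + t) (Suc j)) \<le> ?E * real n ^ Suc j + ?C * real n ^ j"
    unfolding distrib_right by linarith
qed

theorem theorem1p8:
  fixes q s t m :: nat
  assumes "q \<ge> 2" and "1 \<le> s" and "s \<le> t" and "m \<ge> 1"
  shows "\<exists>g :: nat \<Rightarrow> real.
           g \<in> O(\<lambda>n. real n powi (int t - int s - 1)) \<and>
           (\<forall>\<^sub>F n in sequentially.
              real (max_intersection q s t m n)
                \<le> real m * (real q - 1) ^ (t - s) / fact (t - s) * real n ^ (t - s) + g n)"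
proof (cases "t - s")
  \<comment> \<open>For \<open>t = s\<close> the error must be of order \<open>1 / n\<close>. The
    zero function suffices: the ball of radius 0 has size bound 1 and the sum over \<open>r\<close>
    is empty, so the maximum is at most \<open>m\<close>.\<close>
  case 0
  have "\<forall>\<^sub>F n in sequentially. real (max_intersection q s t m n) \<le> real m"
    using eventually_gt_at_top[of s]
  proof eventually_elim
    case (elim n)
    then show ?case
      using max_intersection_le[of q s t n m] assms 0 by (simp add: ball_size_def)
  qed
  then show ?thesis
    using 0 by (intro exI[of _ "\<lambda>_. 0"]) simp
next
  case (Suc j)
  obtain C where C: "\<And>n. n \<ge> 1 \<Longrightarrow> t \<le> n \<Longrightarrow> real (ball_size q (n + t) (Suc j))
      \<le> real (q - 1) ^ Suc j / fact (Suc j) * real n ^ Suc j + C * real n ^ j"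
    using ball_size_asymp by blast
  \<comment> \<open>For \<open>r > s\<close> the remaining radius \<open>t - r\<close> is at most
    \<open>j\<close>, so these balls enter only the error term. \<open>D\<close> collects their
    constants, and \<open>m * C\<close> is the error from the balls of radius
    \<open>t - s\<close>.\<close>
  define D where
    "D = (\<Sum>r\<in>{s<..t}. real ((2 * r) choose r) * (\<Sum>i\<le>t - r. 2 ^ i * real (q - 1) ^ i))"
  define g where "g = (\<lambda>n. (real m * C + D) * real n ^ j)"
  have "int t - int s - 1 = int j"
    using Suc by linarith
  then have "g \<in> O(\<lambda>n. real n powi (int t - int s - 1))"
    by (simp add: g_def)
  moreover have "\<forall>\<^sub>F n in sequentially. real (max_intersection q s t m n)
      \<le> real m * (real q - 1) ^ (t - s) / fact (t - s) * real n ^ (t - s) + g n"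
    using eventually_gt_at_top[of "t + s"]
  proof eventually_elim
    case (elim n)
    have "real (max_intersection q s t m n) \<le> real (m * ball_size q (n + t) (t - s)
      + (\<Sum>r\<in>{s<..t}. ((2 * r) choose r) * ball_size q (n + t) (t - r)))"
      using max_intersection_le[of q s t n m] assms elim by (intro of_nat_mono) simp
    also have "\<dots> = real m * real (ball_size q (n + t) (Suc j))
      + (\<Sum>r\<in>{s<..t}. real ((2 * r) choose r) * real (ball_size q (n + t) (t - r)))"
      using Suc by simp
    also have "\<dots> \<le> real m * (real (q - 1) ^ Suc j / fact (Suc j) * real n ^ Suc j + C * real n ^ j)
      + (\<Sum>r\<in>{s<..t}. real ((2 * r) choose r) *
          ((\<Sum>i\<le>t - r. 2 ^ i * real (q - 1) ^ i) * real n ^ j))"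
      using elim Suc by (intro add_mono mult_left_mono sum_mono C ball_size_le_power) auto
    also have "\<dots> = real m * (real q - 1) ^ Suc j / fact (Suc j) * real n ^ Suc j + g n"
      using assms by (simp add: g_def D_def sum_distrib_right distrib_left distrib_right of_nat_diff
          mult.assoc del: fact_Suc power_Suc)
    finally show ?case
      using Suc by simp
  qed
  ultimately show ?thesis by blast
qed

end
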